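(* Let $(X,d)$ be a metric space, let $C(X)$ be the collection of nonempty closed subsets of $X$, and let $A\in C(X)$. Let $\tau_{V^-}$ be the lower Vietoris topology on $C(X)$. If $B_{H^-}(A,\epsilon)\in\tau_{V^-}$ for every $\epsilon>0$, then each $C\in C(X)$ with $C\subset A$ has the property $Q$.
   Context: For $C\subset X$ and $\epsilon>0$, $B(C,\epsilon)=\bigcup_{c\in C}B(c,\epsilon)$ is the union of open $\epsilon$-balls centered at points of $C$. For $A\in C(X)$, $B_{H^-}(A,\epsilon)=\{C\in C(X):A\subset B(C,\epsilon)\}$. The lower Vietoris topology $\tau_{V^-}$ on $C(X)$ has as a subbase all sets $U^-=\{C\in C(X):C\cap U\neq\emptyset\}$ with $U$ a nonempty open subset of $X$. A nonempty subset $S$ of $X$ has the property $Q$ if $\gamma(S)=0$, where $\gamma(S)=\inf\{\epsilon>0:\{a\in S:d(a,S\setminus\{a\})>\epsilon\}\text{ is finite}\}$ (taken to be $0$ if this set is finite for all $\epsilon>0$); i.e., for every $\epsilon>0$ the set $\{a\in S:d(a,S\setminus\{a\})>\epsilon\}$ is finite. *)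

theory Defs
  imports "HOL-Analysis.Analysis"
begin

text \<open>The hyperspace \<open>C(X)\<close> of nonempty closed subsets; \<open>X\<close> is the whole type \<open>'a\<close>.\<close>

definition closed_hyperspace :: "'a::topological_space set set"
  where "closed_hyperspace = {C. closed C \<and> C \<noteq> {}}"

definition ball_enlargement :: "'a::metric_space set \<Rightarrow> real \<Rightarrow> 'a set"
  where "ball_enlargement C \<epsilon> = (\<Union>c\<in>C. ball c \<epsilon>)"

definition lower_hausdorff_ball :: "'a::metric_space set \<Rightarrow> real \<Rightarrow> 'a set set"
  where "lower_hausdorff_ball A \<epsilon> = {C \<in> closed_hyperspace. A \<subseteq> ball_enlargement C \<epsilon>}"

definition hit_set :: "'a::topological_space set \<Rightarrow> 'a set set"
  where "hit_set U = {C \<in> closed_hyperspace. C \<inter> U \<noteq> {}}"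

text \<open>
  The underlying set of \<open>topology_generated_by\<close> is the union of the subbase.  Since \<open>UNIV\<close> is
  open and nonempty, this union is \<open>hit_set UNIV\<close>, that is, \<open>closed_hyperspace\<close>.
\<close>

definition lower_vietoris :: "'a::topological_space set topology"
  where "lower_vietoris = topology_generated_by {hit_set U | U. open U \<and> U \<noteq> {}}"

lemma topspace_lower_vietoris:
  "topspace lower_vietoris = (closed_hyperspace :: 'a::topological_space set set)"
proof -
  have "(\<Union>U\<in>{U. open U \<and> U \<noteq> {}}. hit_set U) = (closed_hyperspace :: 'a set set)"
  proof
    show "closed_hyperspace \<subseteq> (\<Union>U\<in>{U::'a set. open U \<and> U \<noteq> {}}. hit_set U)"
    proof
      fix C :: "'a set" assume "C \<in> closed_hyperspace"
      then have "C \<in> hit_set UNIV" by (simp add: hit_set_def closed_hyperspace_def)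
      then show "C \<in> (\<Union>U\<in>{U::'a set. open U \<and> U \<noteq> {}}. hit_set U)"
        by (intro UN_I[of UNIV]) simp_all
    qed
  qed (auto simp: hit_set_def)
  then show ?thesis
    by (simp add: lower_vietoris_def image_Collect)
qed

text \<open>
  The infimum is taken in the extended reals, so that it is \<open>\<infinity>\<close> if no \<open>\<epsilon>\<close> qualifies.
  For a singleton \<open>S = {a}\<close> the distance to the empty set occurs, which is \<open>0\<close> for
  \<open>infdist\<close> and usually \<open>\<infinity>\<close>; the set of points is finite under either convention.
\<close>

definition isolation_gamma :: "'a::metric_space set \<Rightarrow> ereal"
  where "isolation_gamma S =
    (INF \<epsilon>\<in>{\<epsilon>::real. \<epsilon> > 0 \<and> finite {a \<in> S. infdist a (S - {a}) > \<epsilon>}}. ereal \<epsilon>)"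

definition property_Q :: "'a::metric_space set \<Rightarrow> bool"
  where "property_Q S \<longleftrightarrow> S \<noteq> {} \<and> isolation_gamma S = 0"

end

theory Submission imports Defs
begin

text \<open>A \<open>\<tau>\<^sub>V\<^sub>-\<close>-open set containing \<open>A\<close> has a nonempty finite subset of
  \<open>A\<close> as an element. Applied to
  \<open>B\<^sub>H\<^sub>-(A, \<epsilon>)\<close>, this makes \<open>A\<close> totally bounded. Points of \<open>C \<subseteq> A\<close> at distance more than
  \<open>\<epsilon>\<close> from the rest of \<open>C\<close> are \<open>\<epsilon>\<close>-separated, so a totally bounded \<open>A\<close> has room for
  finitely many of them only.\<close>

lemma lower_vietoris_finite_core:
  fixes A :: "'a::topological_space set"
  assumes "openin lower_vietoris W" and "A \<in> W"
  obtains F where "finite F" "F \<noteq> {}" "F \<subseteq> A"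
    "\<And>D. D \<in> closed_hyperspace \<Longrightarrow> F \<subseteq> D \<Longrightarrow> D \<in> W"
proof -
  have "generate_topology_on {hit_set U | U::'a set. open U \<and> U \<noteq> {}} W"
    using assms(1) by (simp add: lower_vietoris_def openin_topology_generated_by_iff)
  \<comment> \<open>Quantifying over all closed \<open>D\<close> above \<open>F\<close> makes the
    claim stable under intersections: the union of two cores serves both sets. A union inherits the
    core of a member containing \<open>A\<close>, and a hit set needs one point. Nonemptiness of
    \<open>F\<close> is carried along so that \<open>F\<close> itself can later be used as
    \<open>D\<close>.\<close>
  then have "A \<in> W \<longrightarrow> (\<exists>F. finite F \<and> F \<noteq> {} \<and> F \<subseteq> A \<and>
      (\<forall>D\<in>closed_hyperspace. F \<subseteq> D \<longrightarrow> D \<in> W))"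
  proof induction
    case Empty
    then show ?case by simp
  next
    case (Int V W)
    show ?case
    proof
      assume "A \<in> V \<inter> W"
      with Int.IH obtain F G where
        "finite F" "F \<noteq> {}" "F \<subseteq> A" "\<forall>D\<in>closed_hyperspace. F \<subseteq> D \<longrightarrow> D \<in> V"
        "finite G" "G \<subseteq> A" "\<forall>D\<in>closed_hyperspace. G \<subseteq> D \<longrightarrow> D \<in> W"
        by blast
      then show "\<exists>F. finite F \<and> F \<noteq> {} \<and> F \<subseteq> A \<and>
          (\<forall>D\<in>closed_hyperspace. F \<subseteq> D \<longrightarrow> D \<in> V \<inter> W)"
        by (intro exI[of _ "F \<union> G"]) auto
    qed
  next
    case (UN K)
    then show ?case by (meson UnionE UnionI)
  next
    case (Basis W)
    then obtain U where U: "W = hit_set U" by blast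
    show ?case
    proof
      assume "A \<in> W"
      then obtain a where "a \<in> A" "a \<in> U" by (auto simp: U hit_set_def)
      then show "\<exists>F. finite F \<and> F \<noteq> {} \<and> F \<subseteq> A \<and>
          (\<forall>D\<in>closed_hyperspace. F \<subseteq> D \<longrightarrow> D \<in> W)"
        by (intro exI[of _ "{a}"]) (auto simp: U hit_set_def)
    qed
  qed
  with assms(2) that show thesis by blast
qed

text \<open>A finite subset of a metric space is closed, so the nonempty core \<open>F\<close> of
  the ball around \<open>A\<close> is itself a point of the hyperspace. Taking \<open>D = F\<close>
  turns membership in the ball into the net property.\<close>

lemma finite_net_if_lower_hausdorff_ball_open:
  fixes A :: "'a::metric_space set"
  assumes "A \<in> closed_hyperspace" and "\<epsilon> > 0"
    and "openin lower_vietoris (lower_hausdorff_ball A \<epsilon>)"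
  obtains F where "finite F" "A \<subseteq> ball_enlargement F \<epsilon>"
proof -
  have "A \<in> lower_hausdorff_ball A \<epsilon>"
    using assms(1,2) by (auto simp: lower_hausdorff_ball_def ball_enlargement_def)
  with assms(3) obtain F where F: "finite F" "F \<noteq> {}"
    "\<And>D. D \<in> closed_hyperspace \<Longrightarrow> F \<subseteq> D \<Longrightarrow> D \<in> lower_hausdorff_ball A \<epsilon>"
    by (rule lower_vietoris_finite_core) blast
  then have "F \<in> lower_hausdorff_ball A \<epsilon>"
    by (simp add: closed_hyperspace_def finite_imp_closed)
  with F(1) that show thesis by (simp add: lower_hausdorff_ball_def)
qed

text \<open>Pigeonhole: two points of \<open>T\<close> with the same centre in \<open>F\<close>
  would be less than \<open>\<epsilon> / 2 + \<epsilon> / 2\<close> apart, so choosing centres is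
  injective.\<close>

lemma finite_if_separated_in_finite_net:
  fixes T :: "'a::metric_space set"
  assumes "finite F" and "T \<subseteq> ball_enlargement F (\<epsilon> / 2)"
    and sep: "\<And>a b. a \<in> T \<Longrightarrow> b \<in> T \<Longrightarrow> a \<noteq> b \<Longrightarrow> dist a b \<ge> \<epsilon>"
  shows "finite T"
proof -
  have "\<forall>a\<in>T. \<exists>c\<in>F. dist c a < \<epsilon> / 2"
    using assms(2) unfolding ball_enlargement_def by (fastforce simp only: subset_iff UN_iff mem_ball)
  then obtain f where f: "\<And>a. a \<in> T \<Longrightarrow> f a \<in> F \<and> dist (f a) a < \<epsilon> / 2"
    by metis
  have "inj_on f T"
  proof (rule inj_onI, rule ccontr)
    fix a b assume "a \<in> T" "b \<in> T" "f a = f b" "a \<noteq> b"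
    then show False
      using f[of a] f[of b] sep[of a b] dist_triangle3[of a b "f a"] by simp
  qed
  moreover have "f ` T \<subseteq> F" using f by blast
  ultimately show ?thesis using assms(1) by (meson finite_subset finite_imageD)
qed

lemma isolation_gamma_eq_0:
  fixes S :: "'a::metric_space set"
  assumes "\<And>\<epsilon>::real. \<epsilon> > 0 \<Longrightarrow> finite {a \<in> S. infdist a (S - {a}) > \<epsilon>}"
  shows "isolation_gamma S = 0"
proof (rule antisym)
  show "isolation_gamma S \<le> 0"
  \<comment> \<open>By assumption every real \<open>e > 0\<close> is an admissible index, so the
    infimum is at most \<open>e\<close>.\<close>
  proof (rule ereal_le_epsilon2)
    fix e :: real assume "0 < e"
    then show "isolation_gamma S \<le> 0 + ereal e"
      unfolding isolation_gamma_def using assms by (auto intro: INF_lower)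
  qed
  show "0 \<le> isolation_gamma S"
    unfolding isolation_gamma_def by (rule INF_greatest) auto
qed

theorem theorem4p5:
  fixes A :: "'a::metric_space set"
  assumes "A \<in> closed_hyperspace"
    and "\<And>\<epsilon>::real. \<epsilon> > 0 \<Longrightarrow> openin lower_vietoris (lower_hausdorff_ball A \<epsilon>)"
  shows "\<forall>C \<in> closed_hyperspace. C \<subseteq> A \<longrightarrow> property_Q C"
proof (intro ballI impI)
  fix C :: "'a set" assume C: "C \<in> closed_hyperspace" "C \<subseteq> A"
  have "finite {a \<in> C. infdist a (C - {a}) > \<epsilon>}" if "\<epsilon> > 0" for \<epsilon> :: real
  proof -
    \<comment> \<open>The net is for \<open>A\<close>; its centres need not lie in \<open>C\<close>.
      Half the radius matches the separation \<open>\<epsilon>\<close>.\<close>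
    obtain F where F: "finite F" "A \<subseteq> ball_enlargement F (\<epsilon> / 2)"
      using finite_net_if_lower_hausdorff_ball_open[OF assms(1), of "\<epsilon> / 2"] assms(2) \<open>\<epsilon> > 0\<close>
      by auto
    show ?thesis
    proof (rule finite_if_separated_in_finite_net[OF F(1)])
      show "{a \<in> C. infdist a (C - {a}) > \<epsilon>} \<subseteq> ball_enlargement F (\<epsilon> / 2)"
        using F(2) C(2) by blast
    next
      fix a b
      assume "a \<in> {a \<in> C. infdist a (C - {a}) > \<epsilon>}" "b \<in> {a \<in> C. infdist a (C - {a}) > \<epsilon>}" "a \<noteq> b"
      \<comment> \<open>Here \<open>b\<close> lies in \<open>C - {a}\<close>, so
        \<open>\<epsilon> < infdist a (C - {a}) \<le> dist a b\<close>.\<close>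
      then show "dist a b \<ge> \<epsilon>"
        using infdist_le[of b "C - {a}" a] by auto
    qed
  qed
  then have "isolation_gamma C = 0" by (rule isolation_gamma_eq_0)
  with C(1) show "property_Q C" by (simp add: property_Q_def closed_hyperspace_def)
qed

end
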